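(* Let $e\geq 1$, $n\geq 2$, and let $s\in G(e,e,n)$ be the reflection with reflecting hyperplane $z_i=\zeta z_j$ ($i\neq j$, $\zeta\in\mu_e$). The sign of the permutation induced by $s$ on the set of reflecting hyperplanes of $G(e,e,n)$ is $(-1)^{(n-2)e+(e-2)/2}=(-1)^{(e-2)/2}$ if $e$ is even, and $(-1)^{(n-2)e+(e-1)/2}=(-1)^{n+(e-1)/2}$ if $e$ is odd.
   Context: $\mu_e$ is the group of $e$-th roots of unity. $G(e,e,n)$ is the group of $n\times n$ monomial matrices with nonzero entries in $\mu_e$ whose product is $1$, acting on $\mathbb{C}^n$; its reflecting hyperplanes are $z_a=\xi z_b$ for $a<b$, $\xi\in\mu_e$. *)

theory Defs
  imports "HOL-Analysis.Analysis" "HOL-Combinatorics.Permutations"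
begin

text \<open>The group of e-th roots of unity.\<close>
definition mu :: "nat \<Rightarrow> complex set" where
  "mu e = {\<xi>. \<xi> ^ e = 1}"

text \<open>G(e,e,n): n x n monomial matrices (n = CARD('n)) with nonzero entries
  in mu e whose product (of the nonzero entries) is 1.\<close>
definition Geen :: "nat \<Rightarrow> (complex ^ 'n ^ 'n) set" where
  "Geen e = {M. (\<forall>i. \<exists>!j. M $ i $ j \<noteq> 0) \<and> (\<forall>j. \<exists>!i. M $ i $ j \<noteq> 0)
               \<and> (\<forall>i j. M $ i $ j \<noteq> 0 \<longrightarrow> M $ i $ j \<in> mu e)
               \<and> (\<Prod>i\<in>UNIV. \<Prod>j\<in>UNIV. if M $ i $ j = 0 then 1 else M $ i $ j) = 1}"

text \<open>The hyperplane z_a = xi z_b in C^n.\<close>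
definition hyp :: "'n \<Rightarrow> complex \<Rightarrow> 'n \<Rightarrow> (complex ^ 'n) set" where
  "hyp a \<xi> b = {z. z $ a = \<xi> * z $ b}"

text \<open>The reflecting hyperplanes of G(e,e,n): z_a = xi z_b, a \<noteq> b, xi in mu e.\<close>
definition refl_hyps :: "nat \<Rightarrow> (complex ^ 'n) set set" where
  "refl_hyps e = {hyp a \<xi> b | a b \<xi>. a \<noteq> b \<and> \<xi> \<in> mu e}"

text \<open>s is a reflection with reflecting hyperplane H: s is not the identity,
  has finite order, and its fixed-point set is exactly the hyperplane H.\<close>
definition reflection_with_hyperplane :: "complex ^ 'n ^ 'n \<Rightarrow> (complex ^ 'n) set \<Rightarrow> bool" where
  "reflection_with_hyperplane s H \<longleftrightarrow> s \<noteq> mat 1 \<and> (\<exists>m>0. (((**) s) ^^ m) (mat 1) = mat 1)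
      \<and> {z. s *v z = z} = H"

text \<open>The map induced by a matrix on sets of vectors (on hyperplanes).\<close>
definition hyp_action :: "complex ^ 'n ^ 'n \<Rightarrow> (complex ^ 'n) set \<Rightarrow> (complex ^ 'n) set" where
  "hyp_action s H = (\<lambda>z. s *v z) ` H"

end

(*
  A monomial matrix fixing the hyperplane z_i = zeta z_j pointwise, other than the identity,
  must send z to the vector with z_i := zeta z_j, z_j := z_i / zeta and all other coordinates
  unchanged.  This map is an involution, so the sign of the permutation it induces on the
  reflecting hyperplanes is (-1)^(m/2), where m is the number of hyperplanes it moves.
  The hyperplanes z_a = xi z_b with {a, b} disjoint from {i, j} are fixed, and so are
  z_i = zeta z_j and, when -zeta is an e-th root of unity (i.e. e is even), z_i = -zeta z_j.
  The moved ones are z_a = xi z_k with a in {i, j} and k not in {i, j}, of which there are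
  2e(n - 2), and z_i = xi z_j with xi not in {zeta, -zeta}, of which there are e - 2 or e - 1.
*)
theory Submission
  imports Defs
begin

section \<open>Roots of unity and the hyperplanes z_a = \<xi> z_b\<close>

lemma mu_nonzero: "e > 0 \<Longrightarrow> \<xi> \<in> mu e \<Longrightarrow> \<xi> \<noteq> 0"
  by (auto simp: mu_def power_0_left)

lemma mu_mult: "\<xi> \<in> mu e \<Longrightarrow> \<eta> \<in> mu e \<Longrightarrow> \<xi> * \<eta> \<in> mu e"
  by (simp add: mu_def power_mult_distrib)

lemma mu_divide: "\<xi> \<in> mu e \<Longrightarrow> \<eta> \<in> mu e \<Longrightarrow> \<xi> / \<eta> \<in> mu e"
  by (simp add: mu_def power_divide)

lemma card_mu: "e > 0 \<Longrightarrow> card (mu e) = e"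
  unfolding mu_def by (rule card_roots_unity_eq)

lemma finite_mu: "e > 0 \<Longrightarrow> finite (mu e)"
  using card_mu[of e] by (intro card_ge_0_finite) simp

lemma uminus_mu_iff:
  assumes "\<zeta> \<in> mu e"
  shows "- \<zeta> \<in> mu e \<longleftrightarrow> even e"
proof -
  have "(- \<zeta>) ^ e = (- 1) ^ e * \<zeta> ^ e"
    by (rule power_minus)
  moreover have "(- 1 :: complex) ^ e = 1 \<longleftrightarrow> even e"
    by (cases "even e") (simp_all add: complex_eq_iff)
  ultimately show ?thesis
    using assms by (simp add: mu_def)
qed

lemma card_mu_inter_plus_minus:
  assumes "e > 0" "\<zeta> \<in> mu e"
  shows "card (mu e \<inter> {\<zeta>, - \<zeta>}) = (if even e then 2 else 1)"
proof -
  have "\<zeta> \<noteq> - \<zeta>"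
    using mu_nonzero[OF assms] by simp
  moreover have "mu e \<inter> {\<zeta>, - \<zeta>} = (if even e then {\<zeta>, - \<zeta>} else {\<zeta>})"
    using assms(2) uminus_mu_iff[OF assms(2)] by auto
  ultimately show ?thesis
    by simp
qed

lemma hyp_swap:
  assumes "\<xi> \<noteq> 0"
  shows "hyp a \<xi> b = hyp b (1 / \<xi>) a"
proof -
  have "x = \<xi> * y \<longleftrightarrow> y = 1 / \<xi> * x" for x y :: complex
    using assms by (auto simp: field_simps)
  then show ?thesis
    by (simp add: hyp_def)
qed

lemma hyp_eq_iff:
  fixes a b c d :: "'n::finite"
  assumes "a \<noteq> b" "c \<noteq> d" "\<xi> \<noteq> 0" "\<eta> \<noteq> 0"
  shows "hyp a \<xi> b = hyp c \<eta> d \<longleftrightarrow>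
    (c = a \<and> d = b \<and> \<eta> = \<xi>) \<or> (c = b \<and> d = a \<and> \<eta> * \<xi> = 1)"
proof
  assume eq: "hyp a \<xi> b = hyp c \<eta> d"
  have mem: "z $ a = \<xi> * z $ b \<longleftrightarrow> z $ c = \<eta> * z $ d" for z
    using eq by (auto simp: hyp_def set_eq_iff)
  have c: "c \<in> {a, b}"
  proof (rule ccontr)
    assume "c \<notin> {a, b}"
    then show False
      using mem[of "axis c 1"] assms(2) by (auto simp: axis_def)
  qed
  have d: "d \<in> {a, b}"
  proof (rule ccontr)
    assume "d \<notin> {a, b}"
    then show False
      using mem[of "axis d 1"] assms(2,4) by (auto simp: axis_def)
  qed
  define v :: "complex ^ 'n" where "v = (\<chi> k. if k = a then \<xi> else if k = b then 1 else 0)"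
  have "v $ c = \<eta> * v $ d"
    using mem[of v] assms(1) by (simp add: v_def)
  then show "(c = a \<and> d = b \<and> \<eta> = \<xi>) \<or> (c = b \<and> d = a \<and> \<eta> * \<xi> = 1)"
    using c d assms(1,2) by (auto simp: v_def)
next
  assume "(c = a \<and> d = b \<and> \<eta> = \<xi>) \<or> (c = b \<and> d = a \<and> \<eta> * \<xi> = 1)"
  moreover have "\<eta> * \<xi> = 1 \<Longrightarrow> \<eta> = 1 / \<xi>"
    using assms(3) by (simp add: eq_divide_eq)
  ultimately show "hyp a \<xi> b = hyp c \<eta> d"
    using hyp_swap[OF assms(3), of a b] by auto
qed

lemma hyp_eq_imp_indices_eq:
  assumes "a \<noteq> b" "c \<noteq> d" "\<xi> \<noteq> 0" "\<eta> \<noteq> 0" "hyp a \<xi> b = hyp c \<eta> d"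
  shows "{c, d} = {a, b}"
  using hyp_eq_iff[OF assms(1-4)] assms(5) by auto

lemma hyp_same_indices_eq_iff:
  "a \<noteq> b \<Longrightarrow> \<xi> \<noteq> 0 \<Longrightarrow> \<eta> \<noteq> 0 \<Longrightarrow> hyp a \<xi> b = hyp a \<eta> b \<longleftrightarrow> \<eta> = \<xi>"
  using hyp_eq_iff[of a b a b \<xi> \<eta>] by simp

lemma finite_refl_hyps:
  assumes "e > 0"
  shows "finite (refl_hyps e)"
proof -
  have "refl_hyps e \<subseteq> (\<lambda>(a, b, \<xi>). hyp a \<xi> b) ` (UNIV \<times> UNIV \<times> mu e)"
    by (auto simp: refl_hyps_def)
  then show ?thesis
    using finite_mu[OF assms] finite_subset by fastforce
qed

lemma hyp_neq_if_index_notin: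
  assumes "a \<noteq> k" "c \<noteq> d" "\<xi> \<noteq> 0" "\<eta> \<noteq> 0" "k \<notin> {c, d}"
  shows "hyp a \<xi> k \<noteq> hyp c \<eta> d"
  using hyp_eq_imp_indices_eq[OF assms(1-4)] assms(5) by blast

section \<open>The reflection with hyperplane z_i = \<zeta> z_j\<close>

definition refl_coeff :: "'n \<Rightarrow> 'n \<Rightarrow> complex \<Rightarrow> 'n \<Rightarrow> complex" where
  "refl_coeff i j \<zeta> k = (if k = i then \<zeta> else if k = j then 1 / \<zeta> else 1)"

definition refl_map :: "'n::finite \<Rightarrow> 'n \<Rightarrow> complex \<Rightarrow> complex ^ 'n \<Rightarrow> complex ^ 'n" where
  "refl_map i j \<zeta> z = (\<chi> k. refl_coeff i j \<zeta> k * z $ Transposition.transpose i j k)"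

lemma Geen_entry_unique:
  assumes "s \<in> Geen e"
  shows Geen_row_unique: "s $ a $ b \<noteq> 0 \<Longrightarrow> s $ a $ c \<noteq> 0 \<Longrightarrow> b = c"
    and Geen_col_unique: "s $ a $ b \<noteq> 0 \<Longrightarrow> s $ c $ b \<noteq> 0 \<Longrightarrow> a = c"
proof -
  have "\<forall>a. \<exists>!b. s $ a $ b \<noteq> 0" "\<forall>b. \<exists>!a. s $ a $ b \<noteq> 0"
    using assms by (simp_all add: Geen_def)
  then show "s $ a $ b \<noteq> 0 \<Longrightarrow> s $ a $ c \<noteq> 0 \<Longrightarrow> b = c"
    and "s $ a $ b \<noteq> 0 \<Longrightarrow> s $ c $ b \<noteq> 0 \<Longrightarrow> a = c"
    by metis+
qed

lemma reflection_fixes_hyperplane: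
  "reflection_with_hyperplane s H \<Longrightarrow> z \<in> H \<Longrightarrow> s *v z = z"
  by (auto simp: reflection_with_hyperplane_def)

lemma Geen_reflection_entry_off_block:
  fixes s :: "complex ^ 'n ^ 'n"
  assumes s: "s \<in> Geen e" "reflection_with_hyperplane s (hyp i \<zeta> j)"
    and ab: "a \<notin> {i, j} \<or> b \<notin> {i, j}"
  shows "s $ a $ b = (if a = b then 1 else 0)"
proof -
  have col: "s $ a $ k = (if a = k then 1 else 0)" if "k \<noteq> i" "k \<noteq> j" for a k
  proof -
    have "(s *v axis k 1) $ a = axis k 1 $ a"
      using reflection_fixes_hyperplane[OF s(2), of "axis k 1"] that by (simp add: hyp_def axis_def)
    then show ?thesis
      by (simp add: matrix_vector_mult_def axis_def if_distrib[where f="\<lambda>x. _ * x"] cong: if_cong)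
  qed
  have "s $ a $ b = (if a = b then 1 else 0)" if "a \<noteq> i" "a \<noteq> j"
    using col[OF that, of a] Geen_row_unique[OF s(1), of a b a] by auto
  then show ?thesis
    using ab col by auto
qed

lemma Geen_reflection_entry:
  fixes s :: "complex ^ 'n ^ 'n"
  assumes ij: "i \<noteq> j" and \<zeta>: "\<zeta> \<noteq> 0"
    and s: "s \<in> Geen e" "reflection_with_hyperplane s (hyp i \<zeta> j)"
  shows "s $ a $ b = (if b = Transposition.transpose i j a then refl_coeff i j \<zeta> a else 0)"
proof -
  note off_block = Geen_reflection_entry_off_block[OF s]
  define v :: "complex ^ 'n" where "v = (\<chi> k. if k = i then \<zeta> else if k = j then 1 else 0)"
  have "(s *v v) $ a = s $ a $ i * \<zeta> + s $ a $ j" for a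
  proof -
    have "(s *v v) $ a = (\<Sum>b\<in>{i, j}. s $ a $ b * v $ b)"
      unfolding matrix_vector_mult_def vec_lambda_beta
      by (rule sum.mono_neutral_right) (auto simp: v_def)
    then show ?thesis
      using ij by (simp add: v_def)
  qed
  moreover have "s *v v = v"
    using ij by (intro reflection_fixes_hyperplane[OF s(2)]) (simp add: hyp_def v_def)
  ultimately have "s $ a $ i * \<zeta> + s $ a $ j = v $ a" for a
    by simp
  then have row_i: "s $ i $ i * \<zeta> + s $ i $ j = \<zeta>"
    and row_j: "s $ j $ i * \<zeta> + s $ j $ j = 1"
    using ij by (simp_all add: v_def)
  have "s $ i $ i = 0"
  proof (rule ccontr)
    assume "s $ i $ i \<noteq> 0"
    then have "s $ i $ j = 0" "s $ j $ i = 0"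
      using Geen_row_unique[OF s(1), of i i j] Geen_col_unique[OF s(1), of i i j] ij by auto
    then have "s $ a $ b = mat 1 $ a $ b" for a b
      using row_i row_j \<zeta> off_block[of a b]
      by (cases "a = i"; cases "a = j"; cases "b = i"; cases "b = j") (simp_all add: mat_def)
    then show False
      using s(2) by (simp add: reflection_with_hyperplane_def vec_eq_iff)
  qed
  then have "s $ i $ j = \<zeta>"
    using row_i by simp
  then have "s $ j $ j = 0"
    using Geen_col_unique[OF s(1), of i j j] \<zeta> ij by auto
  then have "s $ j $ i = 1 / \<zeta>"
    using row_j \<zeta> by (simp add: field_simps)
  then show ?thesis
    using \<open>s $ i $ i = 0\<close> \<open>s $ i $ j = \<zeta>\<close> \<open>s $ j $ j = 0\<close> off_block[of a b] ij
    by (cases "a = i"; cases "a = j"; cases "b = i"; cases "b = j")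
      (simp_all add: refl_coeff_def Transposition.transpose_def)
qed

lemma Geen_reflection_apply:
  fixes s :: "complex ^ 'n ^ 'n"
  assumes "i \<noteq> j" "\<zeta> \<noteq> 0" "s \<in> Geen e" "reflection_with_hyperplane s (hyp i \<zeta> j)"
  shows "s *v z = refl_map i j \<zeta> z"
proof -
  have "(s *v z) $ a = (\<Sum>b\<in>UNIV. if b = Transposition.transpose i j a then refl_coeff i j \<zeta> a * z $ b else 0)" for a
    unfolding matrix_vector_mult_def vec_lambda_beta Geen_reflection_entry[OF assms]
    by (intro sum.cong) auto
  then show ?thesis
    by (simp add: vec_eq_iff refl_map_def)
qed

lemma refl_coeff_nonzero: "\<zeta> \<noteq> 0 \<Longrightarrow> refl_coeff i j \<zeta> k \<noteq> 0"
  by (simp add: refl_coeff_def)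

lemma refl_coeff_mu: "\<zeta> \<in> mu e \<Longrightarrow> refl_coeff i j \<zeta> k \<in> mu e"
  by (simp add: refl_coeff_def mu_def power_divide)

lemma refl_map_involution:
  assumes "i \<noteq> j" "\<zeta> \<noteq> 0"
  shows "refl_map i j \<zeta> (refl_map i j \<zeta> z) = z"
proof -
  have "refl_coeff i j \<zeta> k * refl_coeff i j \<zeta> (Transposition.transpose i j k) = 1" for k
    using assms by (simp add: refl_coeff_def Transposition.transpose_def)
  then show ?thesis
    by (simp add: vec_eq_iff refl_map_def mult.assoc[symmetric])
qed

lemma image_involution_eq_vimage:
  assumes "\<And>x. f (f x) = x"
  shows "f ` A = f -` A"
  using assms by (auto simp: image_iff) metis

lemma refl_map_image_hyp:
  assumes "i \<noteq> j" "\<zeta> \<noteq> 0"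
  shows "refl_map i j \<zeta> ` hyp a \<xi> b =
    hyp (Transposition.transpose i j a) (\<xi> * refl_coeff i j \<zeta> b / refl_coeff i j \<zeta> a)
      (Transposition.transpose i j b)"
proof -
  have "refl_map i j \<zeta> ` hyp a \<xi> b = refl_map i j \<zeta> -` hyp a \<xi> b"
    by (rule image_involution_eq_vimage) (rule refl_map_involution[OF assms])
  also have "\<dots> = hyp (Transposition.transpose i j a) (\<xi> * refl_coeff i j \<zeta> b / refl_coeff i j \<zeta> a)
      (Transposition.transpose i j b)"
    using refl_coeff_nonzero[OF assms(2), of i j a]
    by (auto simp: hyp_def refl_map_def field_simps)
  finally show ?thesis .
qed

lemma refl_map_image_refl_hyps:
  assumes "i \<noteq> j" "\<zeta> \<in> mu e" "e > 0" "H \<in> refl_hyps e"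
  shows "refl_map i j \<zeta> ` H \<in> refl_hyps e"
proof -
  obtain a b \<xi> where H: "H = hyp a \<xi> b" "a \<noteq> b" "\<xi> \<in> mu e"
    using assms(4) by (auto simp: refl_hyps_def)
  have "\<xi> * refl_coeff i j \<zeta> b / refl_coeff i j \<zeta> a \<in> mu e"
    using H(3) assms(2) by (intro mu_divide mu_mult refl_coeff_mu)
  moreover have "Transposition.transpose i j a \<noteq> Transposition.transpose i j b"
    using H(2) transpose_eq_imp_eq by metis
  ultimately show ?thesis
    using H(1) refl_map_image_hyp[OF assms(1) mu_nonzero[OF assms(3,2)]]
    by (auto simp: refl_hyps_def)
qed

lemma refl_map_fixes_hyp_ij_iff:
  assumes "i \<noteq> j" "\<zeta> \<noteq> 0" "\<xi> \<noteq> 0"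
  shows "refl_map i j \<zeta> ` hyp i \<xi> j = hyp i \<xi> j \<longleftrightarrow> \<xi> = \<zeta> \<or> \<xi> = - \<zeta>"
proof -
  have "refl_map i j \<zeta> ` hyp i \<xi> j = hyp j (\<xi> * (1 / \<zeta>) / \<zeta>) i"
    using refl_map_image_hyp[OF assms(1,2), of i \<xi> j] assms(1) by (simp add: refl_coeff_def)
  then have "refl_map i j \<zeta> ` hyp i \<xi> j = hyp i \<xi> j \<longleftrightarrow> \<xi> * (\<xi> * (1 / \<zeta>) / \<zeta>) = 1"
    using hyp_eq_iff[of j i i j "\<xi> * (1 / \<zeta>) / \<zeta>" \<xi>] assms by auto
  also have "\<dots> \<longleftrightarrow> \<xi> ^ 2 = \<zeta> ^ 2"
    using assms(2) by (auto simp: field_simps power2_eq_square)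
  also have "\<dots> \<longleftrightarrow> \<xi> = \<zeta> \<or> \<xi> = - \<zeta>"
    by (rule power2_eq_iff)
  finally show ?thesis .
qed

text \<open>Apart from its own hyperplane, a reflection stabilises exactly the hyperplanes containing
  its root line, which here is spanned by the vector with z_i = - \<zeta> z_j and all other
  coordinates 0.\<close>

lemma refl_map_fixes_hyp_iff:
  assumes "i \<noteq> j" "\<zeta> \<noteq> 0" "a \<noteq> b" "\<xi> \<noteq> 0"
  shows "refl_map i j \<zeta> ` hyp a \<xi> b = hyp a \<xi> b \<longleftrightarrow>
    {a, b} \<inter> {i, j} = {} \<or> hyp a \<xi> b = hyp i \<zeta> j \<or> hyp a \<xi> b = hyp i (- \<zeta>) j"
proof -
  let ?\<tau> = "Transposition.transpose i j" and ?c = "refl_coeff i j \<zeta>"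
  have image: "refl_map i j \<zeta> ` hyp a \<xi> b = hyp (?\<tau> a) (\<xi> * ?c b / ?c a) (?\<tau> b)"
    by (rule refl_map_image_hyp[OF assms(1,2)])
  consider "a \<notin> {i, j}" "b \<notin> {i, j}"
    | "?\<tau> a \<notin> {a, b} \<or> ?\<tau> b \<notin> {a, b}" "{a, b} \<noteq> {i, j}" "{a, b} \<inter> {i, j} \<noteq> {}"
    | "{a, b} = {i, j}"
    using assms(1,3) by (cases "a \<in> {i, j}"; cases "b \<in> {i, j}") (auto simp: doubleton_eq_iff)
  then show ?thesis
  proof cases
    case 1
    then show ?thesis
      using image by (simp add: refl_coeff_def)
  next
    case 2
    have \<tau>: "?\<tau> a \<noteq> ?\<tau> b"
      using assms(3) transpose_eq_imp_eq by metis
    have coeff: "\<xi> * ?c b / ?c a \<noteq> 0"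
      using assms(2,4) by (simp add: refl_coeff_nonzero)
    have "refl_map i j \<zeta> ` hyp a \<xi> b \<noteq> hyp a \<xi> b"
    proof
      assume "refl_map i j \<zeta> ` hyp a \<xi> b = hyp a \<xi> b"
      then have "hyp a \<xi> b = hyp (?\<tau> a) (\<xi> * ?c b / ?c a) (?\<tau> b)"
        using image by simp
      then have "{?\<tau> a, ?\<tau> b} = {a, b}"
        by (rule hyp_eq_imp_indices_eq[OF assms(3) \<tau> assms(4) coeff])
      then show False
        using 2(1) by blast
    qed
    moreover have "hyp a \<xi> b \<noteq> hyp i \<eta> j" if "\<eta> \<noteq> 0" for \<eta>
      using 2(2) hyp_eq_imp_indices_eq[OF assms(3,1) assms(4) that] by auto
    ultimately show ?thesis
      using 2(3) assms(2) neg_equal_0_iff_equal by blast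
  next
    case 3
    obtain \<xi>' where \<xi>': "hyp a \<xi> b = hyp i \<xi>' j" "\<xi>' \<noteq> 0"
    proof (cases "a = i")
      case True
      then show ?thesis
        using that[of \<xi>] 3 assms(3,4) by (auto simp: doubleton_eq_iff)
    next
      case False
      then show ?thesis
        using that[of "1 / \<xi>"] 3 assms(4) hyp_swap[OF assms(4), of a b] by (auto simp: doubleton_eq_iff)
    qed
    then show ?thesis
      using refl_map_fixes_hyp_ij_iff[OF assms(1,2) \<xi>'(2)] hyp_same_indices_eq_iff[OF assms(1) \<xi>'(2)]
        3 assms(2) by auto
  qed
qed

section \<open>Sign of an involution\<close>

lemma transpose_comp_involution:
  assumes inv: "\<And>y. p (p y) = y"
  shows "Transposition.transpose x (p x) \<circ> p = (\<lambda>y. if y = x \<or> y = p x then y else p y)"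
proof -
  have "p y \<noteq> x" "p y \<noteq> p x" if "y \<noteq> x" "y \<noteq> p x" for y
    using that inv by metis+
  then show ?thesis
    using inv by (auto simp: fun_eq_iff Transposition.transpose_def)
qed

lemma sign_involution:
  assumes "finite {x. p x \<noteq> x}" "\<And>x. p (p x) = x"
  shows "sign p = (-1) ^ (card {x. p x \<noteq> x} div 2)"
  using assms
proof (induction "card {x. p x \<noteq> x}" arbitrary: p rule: less_induct)
  case less
  show ?case
  proof (cases "p = id")
    case False
    \<comment> \<open>split off the 2-cycle (x p x); what remains is an involution moving two points fewer\<close>
    then obtain x where x: "p x \<noteq> x"
      by (auto simp: fun_eq_iff)
    define y where "y = p x"
    define q where "q = (\<lambda>z. if z = x \<or> z = y then z else p z)"
    have q_eq: "Transposition.transpose x y \<circ> p = q"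
      unfolding q_def y_def by (rule transpose_comp_involution) (rule less.prems(2))
    have p_eq: "p = Transposition.transpose x y \<circ> q"
      unfolding q_eq[symmetric] by (simp add: fun_eq_iff)
    have q_inv: "q (q z) = z" for z
      using less.prems(2) by (simp add: q_def y_def) metis
    have moved_q: "{z. q z \<noteq> z} = {z. p z \<noteq> z} - {x, y}"
      by (auto simp: q_def)
    have sub: "{x, y} \<subseteq> {z. p z \<noteq> z}"
      using x less.prems(2) by (auto simp: y_def)
    have two: "card {x, y} = 2"
      using x by (simp add: y_def)
    have "card {z. q z \<noteq> z} = card {z. p z \<noteq> z} - 2"
      unfolding moved_q using sub two by (simp add: card_Diff_subset)
    moreover have "2 \<le> card {z. p z \<noteq> z}"
      using card_mono[OF less.prems(1) sub] two by linarith
    ultimately have card_p: "card {z. p z \<noteq> z} = card {z. q z \<noteq> z} + 2"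
      by linarith
    have fin_q: "finite {z. q z \<noteq> z}"
      using less.prems(1) by (simp add: moved_q)
    have "permutation q"
      using fin_q q_inv by (auto simp: permutation intro: involuntory_imp_bij)
    moreover have "x \<noteq> y"
      using x by (simp add: y_def)
    ultimately have "sign p = - sign q"
      by (simp add: p_eq sign_compose permutation_swap_id sign_swap_id)
    also have "sign q = (-1) ^ (card {z. q z \<noteq> z} div 2)"
      using less.hyps[of q] card_p fin_q q_inv by simp
    finally show ?thesis
      by (simp add: card_p)
  qed simp
qed

lemma sign_on_involution:
  assumes "finite A" "\<And>x. x \<in> A \<Longrightarrow> f x \<in> A" "\<And>x. x \<in> A \<Longrightarrow> f (f x) = x"
  shows "restrict_id f A permutes A"
    and "sign_on A f = (-1) ^ (card {x \<in> A. f x \<noteq> x} div 2)"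
proof -
  show "restrict_id f A permutes A"
    by (intro permutes_restrict_id bij_betw_byWitness[where f' = f]) (use assms in auto)
  have "{x. restrict_id f A x \<noteq> x} = {x \<in> A. f x \<noteq> x}"
    by (auto simp: restrict_id_def)
  moreover have "sign (restrict_id f A) = (-1) ^ (card {x. restrict_id f A x \<noteq> x} div 2)"
    using assms by (intro sign_involution) (auto simp: restrict_id_def)
  ultimately show "sign_on A f = (-1) ^ (card {x \<in> A. f x \<noteq> x} div 2)"
    by (simp add: sign_on_def)
qed

section \<open>Counting the moved hyperplanes\<close>

definition moved_hyps :: "nat \<Rightarrow> 'n::finite \<Rightarrow> 'n \<Rightarrow> complex \<Rightarrow> (complex ^ 'n) set set" where
  "moved_hyps e i j \<zeta> = {H \<in> refl_hyps e. refl_map i j \<zeta> ` H \<noteq> H}"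

context
  fixes e :: nat and i j :: "'n::finite" and \<zeta> :: complex
  assumes e: "e > 0" and ij: "i \<noteq> j" and \<zeta>: "\<zeta> \<in> mu e"
begin

lemma hyp_in_moved_hyps_iff:
  assumes "a \<noteq> b" "\<xi> \<in> mu e"
  shows "hyp a \<xi> b \<in> moved_hyps e i j \<zeta> \<longleftrightarrow>
    {a, b} \<inter> {i, j} \<noteq> {} \<and> hyp a \<xi> b \<noteq> hyp i \<zeta> j \<and> hyp a \<xi> b \<noteq> hyp i (- \<zeta>) j"
proof -
  have "hyp a \<xi> b \<in> refl_hyps e"
    using assms by (auto simp: refl_hyps_def)
  then show ?thesis
    using refl_map_fixes_hyp_iff[OF ij mu_nonzero[OF e \<zeta>] assms(1) mu_nonzero[OF e assms(2)]]
    by (simp add: moved_hyps_def)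
qed

lemma moved_hyps_subset:
  "moved_hyps e i j \<zeta> \<subseteq>
    (\<lambda>(a, \<xi>, k). hyp a \<xi> k) ` ({i, j} \<times> mu e \<times> (UNIV - {i, j})) \<union>
    (\<lambda>\<xi>. hyp i \<xi> j) ` (mu e - {\<zeta>, - \<zeta>})"
proof
  fix H
  assume H: "H \<in> moved_hyps e i j \<zeta>"
  then obtain a b \<xi> where H_eq: "H = hyp a \<xi> b" and ab: "a \<noteq> b" and \<xi>: "\<xi> \<in> mu e"
    by (auto simp: moved_hyps_def refl_hyps_def)
  have moved: "{a, b} \<inter> {i, j} \<noteq> {}" "H \<noteq> hyp i \<zeta> j" "H \<noteq> hyp i (- \<zeta>) j"
    using H hyp_in_moved_hyps_iff[OF ab \<xi>] by (simp_all add: H_eq)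
  have \<xi>': "1 / \<xi> \<in> mu e"
    using \<xi> by (simp add: mu_def power_divide)
  have H_swap: "H = hyp b (1 / \<xi>) a"
    by (simp add: H_eq hyp_swap[OF mu_nonzero[OF e \<xi>]])
  consider "a \<in> {i, j}" "b \<notin> {i, j}" | "b \<in> {i, j}" "a \<notin> {i, j}" | "a = i" "b = j" | "a = j" "b = i"
    using moved(1) ab by blast
  then show "H \<in> (\<lambda>(a, \<xi>, k). hyp a \<xi> k) ` ({i, j} \<times> mu e \<times> (UNIV - {i, j})) \<union>
      (\<lambda>\<xi>. hyp i \<xi> j) ` (mu e - {\<zeta>, - \<zeta>})"
  proof cases
    case 1
    then show ?thesis
      using H_eq \<xi> by auto
  next
    case 2
    then show ?thesis
      using H_swap \<xi>' by auto
  next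
    case 3
    then have "\<xi> \<notin> {\<zeta>, - \<zeta>}"
      using moved H_eq by auto
    then show ?thesis
      using H_eq 3 \<xi> by auto
  next
    case 4
    then have "1 / \<xi> \<notin> {\<zeta>, - \<zeta>}"
      using moved H_swap by auto
    then show ?thesis
      using H_swap 4 \<xi>' by auto
  qed
qed

lemma moved_hyps_eq:
  "moved_hyps e i j \<zeta> =
    (\<lambda>(a, \<xi>, k). hyp a \<xi> k) ` ({i, j} \<times> mu e \<times> (UNIV - {i, j})) \<union>
    (\<lambda>\<xi>. hyp i \<xi> j) ` (mu e - {\<zeta>, - \<zeta>})"
proof (rule equalityI[OF moved_hyps_subset], intro Un_least subsetI)
  fix H
  assume "H \<in> (\<lambda>(a, \<xi>, k). hyp a \<xi> k) ` ({i, j} \<times> mu e \<times> (UNIV - {i, j}))"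
  then obtain a \<xi> k where H_eq: "H = hyp a \<xi> k" and a: "a \<in> {i, j}" and \<xi>: "\<xi> \<in> mu e"
    and k: "k \<notin> {i, j}"
    by auto
  have ak: "a \<noteq> k"
    using a k by auto
  have "hyp a \<xi> k \<noteq> hyp i \<eta> j" if "\<eta> \<noteq> 0" for \<eta>
    using hyp_neq_if_index_notin[OF ak ij mu_nonzero[OF e \<xi>] that k] .
  then show "H \<in> moved_hyps e i j \<zeta>"
    using hyp_in_moved_hyps_iff[OF ak \<xi>] a mu_nonzero[OF e \<zeta>] by (auto simp: H_eq)
next
  fix H
  assume "H \<in> (\<lambda>\<xi>. hyp i \<xi> j) ` (mu e - {\<zeta>, - \<zeta>})"
  then obtain \<xi> where H_eq: "H = hyp i \<xi> j" and \<xi>: "\<xi> \<in> mu e" "\<xi> \<noteq> \<zeta>" "\<xi> \<noteq> - \<zeta>"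
    by auto
  then show "H \<in> moved_hyps e i j \<zeta>"
    using hyp_in_moved_hyps_iff[OF ij \<xi>(1)] hyp_same_indices_eq_iff[OF ij mu_nonzero[OF e \<xi>(1)]]
      mu_nonzero[OF e \<zeta>] by auto
qed

lemma inj_on_hyp_ij_to_rest:
  "inj_on (\<lambda>(a, \<xi>, k). hyp a \<xi> k) ({i, j} \<times> mu e \<times> (UNIV - {i, j}))"
proof (rule inj_onI)
  fix x y
  assume x: "x \<in> {i, j} \<times> mu e \<times> (UNIV - {i, j})" and y: "y \<in> {i, j} \<times> mu e \<times> (UNIV - {i, j})"
    and eq: "(\<lambda>(a, \<xi>, k). hyp a \<xi> k) x = (\<lambda>(a, \<xi>, k). hyp a \<xi> k) y"
  obtain a \<xi> k a' \<xi>' k' where xy: "x = (a, \<xi>, k)" "y = (a', \<xi>', k')"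
    using prod_cases3 by metis
  have a: "a \<in> {i, j}" "a' \<in> {i, j}" and \<xi>: "\<xi> \<in> mu e" "\<xi>' \<in> mu e"
    and k: "k \<notin> {i, j}" "k' \<notin> {i, j}"
    using x y by (simp_all add: xy)
  have "a \<noteq> k" "a' \<noteq> k'"
    using a k by auto
  then show "x = y"
    using hyp_eq_iff[of a k a' k' \<xi> \<xi>'] eq mu_nonzero[OF e \<xi>(1)] mu_nonzero[OF e \<xi>(2)] a k
    by (auto simp: xy)
qed

lemma card_moved_hyps:
  "card (moved_hyps e i j \<zeta>) = 2 * e * (CARD('n) - 2) + (e - (if even e then 2 else 1))"
proof -
  let ?P = "{i, j} \<times> mu e \<times> (UNIV - {i, j})" and ?R = "mu e - {\<zeta>, - \<zeta>}"
  have inj: "inj_on (\<lambda>\<xi>. hyp i \<xi> j) ?R"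
  proof (rule inj_onI)
    fix \<xi> \<eta>
    assume \<xi>: "\<xi> \<in> ?R" and \<eta>: "\<eta> \<in> ?R" and eq: "hyp i \<xi> j = hyp i \<eta> j"
    have "\<eta> = \<xi>"
      using hyp_same_indices_eq_iff[OF ij mu_nonzero[OF e DiffD1[OF \<xi>]] mu_nonzero[OF e DiffD1[OF \<eta>]]] eq ..
    then show "\<xi> = \<eta>" ..
  qed
  have "hyp a \<xi> k \<noteq> hyp i \<eta> j" if "(a, \<xi>, k) \<in> ?P" "\<eta> \<in> ?R" for a \<xi> k \<eta>
    using that by (intro hyp_neq_if_index_notin ij mu_nonzero[OF e]) auto
  then have disjoint: "(\<lambda>(a, \<xi>, k). hyp a \<xi> k) ` ?P \<inter> (\<lambda>\<xi>. hyp i \<xi> j) ` ?R = {}"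
    by fastforce
  have "card (UNIV - {i, j}) = CARD('n) - 2"
    using ij by (simp add: card_Diff_subset)
  then have "card ?P = 2 * e * (CARD('n) - 2)"
    using ij card_mu[OF e] by (simp add: card_cartesian_product mult.assoc)
  moreover have "card ?R = e - (if even e then 2 else 1)"
    using card_Diff_subset_Int[of "mu e" "{\<zeta>, - \<zeta>}"] card_mu[OF e] card_mu_inter_plus_minus[OF e \<zeta>]
    by simp
  moreover have "finite ?P" "finite ?R"
    using finite_mu[OF e] by simp_all
  ultimately show ?thesis
    unfolding moved_hyps_eq
    using card_Un_disjoint[OF _ _ disjoint] card_image[OF inj_on_hyp_ij_to_rest] card_image[OF inj]
    by simp
qed

end

lemma moved_count_div_2:
  fixes e n :: nat
  shows "(2 * e * (n - 2) + (e - (if even e then 2 else 1))) div 2 =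
    (if even e then (n - 2) * e + (e - 2) div 2 else (n - 2) * e + (e - 1) div 2)"
  by (cases "even e") (auto elim!: evenE oddE)

lemma minus_one_power_reduce_exponent:
  assumes "n \<ge> 2"
  shows "(if even e then (-1::int) ^ ((n - 2) * e + (e - 2) div 2) else (-1) ^ ((n - 2) * e + (e - 1) div 2)) =
    (if even e then (-1) ^ ((e - 2) div 2) else (-1) ^ (n + (e - 1) div 2))"
  using assms by (auto simp: minus_one_power_iff even_mult_iff)

theorem proposition3p9:
  fixes e :: nat and s :: "complex ^ 'n ^ 'n" and i j :: 'n and \<zeta> :: complex
  assumes "e \<ge> 1" and "CARD('n) \<ge> 2"
    and "i \<noteq> j" and "\<zeta> \<in> mu e"
    and "s \<in> Geen e"
    and "reflection_with_hyperplane s (hyp i \<zeta> j)"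
  shows "restrict_id (hyp_action s) (refl_hyps e) permutes (refl_hyps e)
    \<and> sign_on (refl_hyps e) (hyp_action s) =
      (if even e then (-1) ^ ((CARD('n) - 2) * e + (e - 2) div 2)
                 else (-1) ^ ((CARD('n) - 2) * e + (e - 1) div 2))
    \<and> sign_on (refl_hyps e) (hyp_action s) =
      (if even e then (-1) ^ ((e - 2) div 2)
                 else (-1) ^ (CARD('n) + (e - 1) div 2))"
proof -
  have e: "e > 0"
    using assms(1) by simp
  have \<zeta>0: "\<zeta> \<noteq> 0"
    using mu_nonzero[OF e assms(4)] .
  have action: "hyp_action s = (`) (refl_map i j \<zeta>)"
    using Geen_reflection_apply[OF assms(3) \<zeta>0 assms(5,6)] by (simp add: fun_eq_iff hyp_action_def)
  have "refl_map i j \<zeta> ` refl_map i j \<zeta> ` H = H" for H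
    by (simp add: image_image refl_map_involution[OF assms(3) \<zeta>0])
  note involution = sign_on_involution[OF finite_refl_hyps[OF e] refl_map_image_refl_hyps[OF assms(3,4) e] this]
  have "restrict_id (hyp_action s) (refl_hyps e) permutes (refl_hyps e)"
    unfolding action by (rule involution(1))
  moreover have sign: "sign_on (refl_hyps e) (hyp_action s) =
      (-1) ^ (card (moved_hyps e i j \<zeta>) div 2)"
    unfolding action moved_hyps_def by (rule involution(2))
  moreover have "sign_on (refl_hyps e) (hyp_action s) =
      (if even e then (-1) ^ ((CARD('n) - 2) * e + (e - 2) div 2)
                 else (-1) ^ ((CARD('n) - 2) * e + (e - 1) div 2))"
    unfolding sign card_moved_hyps[OF e assms(3,4)] moved_count_div_2 by simp
  ultimately show ?thesis
    using minus_one_power_reduce_exponent[OF assms(2)] by simp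
qed

end
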